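(* Let $\Omega=\Omega_1\times\cdots\times\Omega_n$ be a finite product space, let $\mu$ be a probability measure on $\Omega$, and let $\epsilon>0$. If $\mu$ satisfies property $(\dagger)$ with parameter $\kappa\in(0,1)$, $\kappa\le1-\epsilon/n$, with respect to some (any) metric $d$ on $\Omega$, then $\mu$ is $\eta$-spectrally independent with constant $\eta=1/\epsilon$. Here property $(\dagger)$ with parameter $\kappa$ with respect to $d$ is: for all valid configurations $(X_0,Y_0)\in\Omega\times\Omega$, there exists a coupling $(X_0,Y_0)\to(X_1,Y_1)$ of one step of the Glauber dynamics for $\mu$ satisfying $$\mathbb{E}[d(X_1,Y_1)\mid(X_0,Y_0)]\le\kappa\,d(X_0,Y_0).$$
   Context: Glauber dynamics for $\mu$: at each step select a coordinate $i\in[n]$ uniformly at random and resample it from its conditional law under $\mu$ given all the other coordinates. Valid configurations are those in the support of $\mu$. A coupling of one step means a joint law of $(X_1,Y_1)$ such that $X_1$ (resp. $Y_1$) is distributed as one step of the Glauber dynamics from $X_0$ (resp. $Y_0$). Spectral independence of $\mu$ is that of its homogenization: identify $\sigma\in\Omega$ with the set $\{(\sigma_1,1),\dots,(\sigma_n,n)\}$, giving a distribution $\mu^{\mathrm{hom}}$ on $n$-subsets of $E=\bigcup_i\Omega_i\times\{i\}$. Its correlation matrix is indexed by $E$ (elements of zero probability discarded) with entries $\Psi(a,a)=1-\mathbb{P}[a\in S]$ and $\Psi(a,b)=\mathbb{P}[b\in S\mid a\in S]-\mathbb{P}[b\in S]$ for $a\ne b$, where $S\sim\mu^{\mathrm{hom}}$.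 $\mu$ is $\eta$-spectrally independent if the largest eigenvalue of $\Psi$ is at most $\eta$. *)

theory Defs
  imports "HOL-Probability.Probability" "Jordan_Normal_Form.Spectral_Radius"
begin

text \<open>
  Coordinates are numbered \<open>0, \<dots>, n - 1\<close>. The sets \<open>Om i\<close> live in one ambient type, which is no
  restriction since finitely many types embed into their disjoint sum. A configuration is an
  extensional function, so that \<open>Pi\<^sub>E\<close> is the finite product and equality of configurations is
  equality of their coordinates.
\<close>

definition config_space :: "nat \<Rightarrow> (nat \<Rightarrow> 'a set) \<Rightarrow> (nat \<Rightarrow> 'a) set" where
  "config_space n Om = (\<Pi>\<^sub>E i\<in>{..<n}. Om i)"

text \<open>
  Only meaningful for \<open>x\<close> in the support of \<open>\<mu>\<close>: then the conditioning event has positive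
  probability.
\<close>

definition glauber_step :: "nat \<Rightarrow> (nat \<Rightarrow> 'a) pmf \<Rightarrow> (nat \<Rightarrow> 'a) \<Rightarrow> (nat \<Rightarrow> 'a) pmf" where
  "glauber_step n \<mu> x =
     bind_pmf (pmf_of_set {..<n}) (\<lambda>i.
       map_pmf (\<lambda>\<tau>. x(i := \<tau> i))
         (cond_pmf \<mu> {\<tau>. \<forall>j\<in>{..<n} - {i}. \<tau> j = x j}))"

definition glauber_coupling ::
  "nat \<Rightarrow> (nat \<Rightarrow> 'a) pmf \<Rightarrow> (nat \<Rightarrow> 'a) \<Rightarrow> (nat \<Rightarrow> 'a) \<Rightarrow> ((nat \<Rightarrow> 'a) \<times> (nat \<Rightarrow> 'a)) pmf \<Rightarrow> bool" where
  "glauber_coupling n \<mu> x y C \<longleftrightarrow>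
     map_pmf fst C = glauber_step n \<mu> x \<and> map_pmf snd C = glauber_step n \<mu> y"

text \<open>
  Both marginals of a coupling have finite support when \<open>\<mu>\<close> does, so the expectation below is a
  finite sum.
\<close>

definition dagger_property ::
  "nat \<Rightarrow> (nat \<Rightarrow> 'a) pmf \<Rightarrow> ((nat \<Rightarrow> 'a) \<Rightarrow> (nat \<Rightarrow> 'a) \<Rightarrow> real) \<Rightarrow> real \<Rightarrow> bool" where
  "dagger_property n \<mu> d \<kappa> \<longleftrightarrow>
     (\<forall>x\<in>set_pmf \<mu>. \<forall>y\<in>set_pmf \<mu>. \<exists>C. glauber_coupling n \<mu> x y C \<and>
        measure_pmf.expectation C (\<lambda>(x', y'). d x' y') \<le> \<kappa> * d x y)"

definition homogenization :: "nat \<Rightarrow> (nat \<Rightarrow> 'a) pmf \<Rightarrow> ('a \<times> nat) set pmf" where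
  "homogenization n \<mu> = map_pmf (\<lambda>\<sigma>. (\<lambda>i. (\<sigma> i, i)) ` {..<n}) \<mu>"

definition ground_set :: "nat \<Rightarrow> (nat \<Rightarrow> 'a set) \<Rightarrow> ('a \<times> nat) set" where
  "ground_set n Om = (\<Union>i<n. Om i \<times> {i})"

definition correlation :: "'e set pmf \<Rightarrow> 'e \<Rightarrow> 'e \<Rightarrow> real" where
  "correlation \<nu> a b =
     (if a = b then 1 - \<P>(S in measure_pmf \<nu>. a \<in> S)
      else \<P>(S in measure_pmf \<nu>. b \<in> S \<bar> a \<in> S) - \<P>(S in measure_pmf \<nu>. b \<in> S))"

definition correlation_index :: "'e set \<Rightarrow> 'e set pmf \<Rightarrow> 'e set" where
  "correlation_index E \<nu> = {a \<in> E. \<P>(S in measure_pmf \<nu>. a \<in> S) > 0}"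

text \<open>
  Rows and columns are numbered by \<^const>\<open>from_nat_into\<close>, which enumerates a finite set \<open>I\<close>
  bijectively by \<open>{..<card I}\<close>. Another enumeration conjugates the matrix by a permutation and
  leaves the spectrum unchanged.
\<close>

definition correlation_matrix :: "'e set \<Rightarrow> 'e set pmf \<Rightarrow> real mat" where
  "correlation_matrix E \<nu> =
     (let I = correlation_index E \<nu>; e = from_nat_into I
      in mat (card I) (card I) (\<lambda>(i, j). correlation \<nu> (e i) (e j)))"

text \<open>
  The matrix is conjugate, by the diagonal matrix of the square roots of the \<open>\<P>(a \<in> S) > 0\<close>, to a
  symmetric one. Hence all its complex eigenvalues are real, and the real spectrum is the whole
  spectrum. It is finite, and for \<open>n > 0\<close> it contains \<open>0\<close> (the rows sum to \<open>0\<close>, as \<open>S\<close> always has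
  \<open>n\<close> elements), so that the maximum is that of a finite nonempty set.
\<close>

definition spectrally_independent ::
  "nat \<Rightarrow> (nat \<Rightarrow> 'a set) \<Rightarrow> (nat \<Rightarrow> 'a) pmf \<Rightarrow> real \<Rightarrow> bool" where
  "spectrally_independent n Om \<mu> \<eta> \<longleftrightarrow>
     Max (spectrum (correlation_matrix (ground_set n Om) (homogenization n \<mu>))) \<le> \<eta>"

end

theory Submission
  imports Defs
begin

text \<open>
  A contracting coupling, in whatever metric, forces a spectral gap: the Glauber operator
  \<open>P\<close> contracts Lipschitz constants by \<open>\<kappa>\<close>, and on a finite space every function is Lipschitz, so that on
  functions of mean zero the operator has norm at most \<open>\<kappa>\<close> in the Hilbert space of the stationary
  measure. Since \<open>1 - \<kappa> \<ge> \<epsilon> / n\<close>, every function \<open>f\<close> satisfies the Poincare inequality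
  \<open>\<epsilon> / n * Var f \<le> \<E>(f, f)\<close>, where \<open>\<E>\<close> is the Dirichlet form of the Glauber dynamics.

  Spectral independence is this inequality tested on linear functions
  \<open>f(\<sigma>) = \<phi>\<^sub>0(\<sigma>\<^sub>0) + \<dots> + \<phi>\<^sub>n\<^sub>-\<^sub>1(\<sigma>\<^sub>n\<^sub>-\<^sub>1)\<close>. On the one hand, \<open>\<Psi>\<close> is the covariance matrix of the
  indicators of the events \<open>a \<in> S\<close> with row \<open>a\<close> divided by \<open>\<P>(a \<in> S)\<close>; hence an eigenvector \<open>\<phi>\<close> with
  eigenvalue \<open>\<lambda>\<close> gives \<open>Var f = \<lambda> * \<Sum>a. \<P>(a \<in> S) * \<phi>(a)\<^sup>2 = \<lambda> * \<Sum>i. E \<phi>\<^sub>i\<^sup>2\<close>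
  (lemma \<open>correlation_quadratic_form\<close>). On the other hand, \<open>\<E>\<close> is the average over the sites \<open>i\<close> of the
  Dirichlet forms of the single-site updates, and the update at \<open>i\<close> sees only the \<open>i\<close>-th summand
  and is a conditional expectation, so that \<open>\<E>(f, f) \<le> 1 / n * \<Sum>i. E \<phi>\<^sub>i\<^sup>2\<close>
  (lemma \<open>dirichlet_form_site_additive\<close>). Dividing by the positive number \<open>\<Sum>i. E \<phi>\<^sub>i\<^sup>2\<close> gives
  \<open>\<lambda> \<le> 1 / \<epsilon>\<close>.

  The gap itself (theorem \<open>spectral_gap_of_contraction\<close>) is obtained without diagonalizing the
  operator: the autocorrelations \<open>\<langle>f, P\<^sup>m f\<rangle>\<close> decay like \<open>\<kappa>\<^sup>m\<close>, and by Cauchy-Schwarz they could not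
  if \<open>\<langle>f, P f\<rangle>\<close> exceeded \<open>\<kappa> * \<langle>f, f\<rangle>\<close>.
\<close>

section \<open>Reversible kernels: contraction implies a spectral gap\<close>

definition dirichlet_form :: "'b pmf \<Rightarrow> ('b \<Rightarrow> 'b pmf) \<Rightarrow> ('b \<Rightarrow> real) \<Rightarrow> real" where
  "dirichlet_form \<mu> K f =
     (\<Sum>x\<in>set_pmf \<mu>. \<Sum>y\<in>set_pmf \<mu>. pmf \<mu> x * pmf (K x) y * (f x - f y)\<^sup>2) / 2"

locale reversible_kernel =
  fixes \<mu> :: "'b pmf" and K :: "'b \<Rightarrow> 'b pmf"
  assumes finite_support: "finite (set_pmf \<mu>)"
    and closed: "x \<in> set_pmf \<mu> \<Longrightarrow> set_pmf (K x) \<subseteq> set_pmf \<mu>"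
    and detailed_balance:
      "x \<in> set_pmf \<mu> \<Longrightarrow> y \<in> set_pmf \<mu> \<Longrightarrow> pmf \<mu> x * pmf (K x) y = pmf \<mu> y * pmf (K y) x"
begin

definition step :: "('b \<Rightarrow> real) \<Rightarrow> 'b \<Rightarrow> real" where
  "step f x = measure_pmf.expectation (K x) f"

abbreviation mean :: "('b \<Rightarrow> real) \<Rightarrow> real" where
  "mean \<equiv> measure_pmf.expectation \<mu>"

lemma integrable_support [simp]: "integrable (measure_pmf \<mu>) (f :: 'b \<Rightarrow> real)"
  by (rule integrable_measure_pmf_finite[OF finite_support])

lemma integrable_kernel:
  "x \<in> set_pmf \<mu> \<Longrightarrow> integrable (measure_pmf (K x)) (f :: 'b \<Rightarrow> real)"
  using closed finite_support by (meson finite_subset integrable_measure_pmf_finite)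

lemma mean_eq_sum: "mean f = (\<Sum>x\<in>set_pmf \<mu>. pmf \<mu> x * f x)"
  using integral_measure_pmf_real[OF finite_support, of \<mu> f] by (simp add: mult.commute)

lemma step_eq_sum: "x \<in> set_pmf \<mu> \<Longrightarrow> step f x = (\<Sum>y\<in>set_pmf \<mu>. pmf (K x) y * f y)"
  using integral_measure_pmf_real[OF finite_support, of "K x" f] closed
  by (auto simp: step_def mult.commute)

lemma mean_cong: "(\<And>x. x \<in> set_pmf \<mu> \<Longrightarrow> f x = g x) \<Longrightarrow> mean f = mean g"
  by (simp add: mean_eq_sum)

lemma mean_mono: "(\<And>x. x \<in> set_pmf \<mu> \<Longrightarrow> f x \<le> g x) \<Longrightarrow> mean f \<le> mean g"
  by (simp add: mean_eq_sum sum_mono mult_left_mono)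

lemma mean_nonneg: "(\<And>x. x \<in> set_pmf \<mu> \<Longrightarrow> 0 \<le> f x) \<Longrightarrow> 0 \<le> mean f"
  by (simp add: mean_eq_sum sum_nonneg)

lemma step_const [simp]: "step (\<lambda>_. c) = (\<lambda>_. c)"
  by (simp add: step_def fun_eq_iff)

text \<open>
  Detailed balance says that \<open>\<mu>(x) * K(x, y)\<close>, the matrix of this bilinear form, is symmetric.
\<close>

lemma self_adjoint: "mean (\<lambda>x. f x * step g x) = mean (\<lambda>x. step f x * g x)"
proof -
  have "mean (\<lambda>x. f x * step g x)
      = (\<Sum>x\<in>set_pmf \<mu>. \<Sum>y\<in>set_pmf \<mu>. pmf \<mu> x * pmf (K x) y * f x * g y)"
    by (simp add: mean_eq_sum step_eq_sum sum_distrib_left mult_ac)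
  also have "\<dots> = (\<Sum>x\<in>set_pmf \<mu>. \<Sum>y\<in>set_pmf \<mu>. pmf \<mu> y * pmf (K y) x * f x * g y)"
    by (intro sum.cong refl) (simp add: detailed_balance)
  also have "\<dots> = (\<Sum>y\<in>set_pmf \<mu>. \<Sum>x\<in>set_pmf \<mu>. pmf \<mu> y * pmf (K y) x * f x * g y)"
    by (rule sum.swap)
  also have "\<dots> = mean (\<lambda>x. step f x * g x)"
    by (simp add: mean_eq_sum step_eq_sum sum_distrib_left sum_distrib_right mult_ac)
  finally show ?thesis .
qed

lemma mean_step: "mean (step f) = mean f"
  using self_adjoint[of "\<lambda>_. 1" f] by simp

lemma self_adjoint_power:
  "mean (\<lambda>x. f x * (step ^^ m) g x) = mean (\<lambda>x. (step ^^ m) f x * g x)"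
proof (induction m arbitrary: f)
  case (Suc m)
  have "mean (\<lambda>x. f x * (step ^^ Suc m) g x) = mean (\<lambda>x. step f x * (step ^^ m) g x)"
    by (simp add: self_adjoint)
  also have "\<dots> = mean (\<lambda>x. (step ^^ Suc m) f x * g x)"
    by (simp only: Suc.IH funpow_Suc_right o_apply)
  finally show ?case .
qed simp

lemma mean_step_power: "mean ((step ^^ m) f) = mean f"
  by (induction m) (simp_all add: mean_step)

text \<open>
  The quadratic form of \<open>I - P\<close>, where \<open>P\<close> is the operator \<open>step\<close>. The definition
  by squared differences shows that constants may be subtracted from \<open>f\<close> and that only pairs of
  states joined by a transition matter; both are hidden in the scalar products.
\<close>

lemma dirichlet_form_eq: "dirichlet_form \<mu> K f = mean (\<lambda>x. (f x)\<^sup>2) - mean (\<lambda>x. f x * step f x)"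
proof -
  have diff: "step (\<lambda>y. (f x - f y)\<^sup>2) x = (f x)\<^sup>2 - 2 * (f x * step f x) + step (\<lambda>y. (f y)\<^sup>2) x"
    if "x \<in> set_pmf \<mu>" for x
    using integrable_kernel[OF that] by (simp add: step_def power2_diff)
  have "2 * dirichlet_form \<mu> K f = mean (\<lambda>x. step (\<lambda>y. (f x - f y)\<^sup>2) x)"
    by (simp add: dirichlet_form_def mean_eq_sum step_eq_sum sum_distrib_left mult_ac)
  also have "\<dots> = mean (\<lambda>x. (f x)\<^sup>2 - 2 * (f x * step f x) + step (\<lambda>y. (f y)\<^sup>2) x)"
    by (rule mean_cong) (rule diff)
  also have "\<dots> = 2 * (mean (\<lambda>x. (f x)\<^sup>2) - mean (\<lambda>x. f x * step f x))"
    by (simp add: mean_step)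
  finally show ?thesis by simp
qed

lemma Cauchy_Schwarz_mean: "(mean (\<lambda>x. f x * g x))\<^sup>2 \<le> mean (\<lambda>x. (f x)\<^sup>2) * mean (\<lambda>x. (g x)\<^sup>2)"
proof -
  have "(\<Sum>x\<in>set_pmf \<mu>. (sqrt (pmf \<mu> x) * f x) * (sqrt (pmf \<mu> x) * g x))\<^sup>2
    \<le> (\<Sum>x\<in>set_pmf \<mu>. (sqrt (pmf \<mu> x) * f x)\<^sup>2) * (\<Sum>x\<in>set_pmf \<mu>. (sqrt (pmf \<mu> x) * g x)\<^sup>2)"
    by (rule Cauchy_Schwarz_ineq_sum)
  moreover have "(sqrt (pmf \<mu> x) * f x) * (sqrt (pmf \<mu> x) * g x) = pmf \<mu> x * (f x * g x)" for x
    by (metis mult.assoc mult.left_commute pmf_nonneg real_sqrt_mult_self abs_of_nonneg)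
  ultimately show ?thesis
    by (simp add: mean_eq_sum power_mult_distrib)
qed

text \<open>
  The dual form of a coupling bound: \<open>step f x - step f y\<close> is the expected difference of \<open>f\<close> over any
  coupling of the two steps, and the Lipschitz bound applies inside that expectation.
\<close>

lemma coupling_Lipschitz:
  assumes C: "map_pmf fst C = K x" "map_pmf snd C = K y" "x \<in> set_pmf \<mu>" "y \<in> set_pmf \<mu>"
    and contr: "measure_pmf.expectation C (\<lambda>(x', y'). d x' y') \<le> \<kappa> * d x y"
    and L: "0 \<le> L" "\<And>x y. x \<in> set_pmf \<mu> \<Longrightarrow> y \<in> set_pmf \<mu> \<Longrightarrow> \<bar>f x - f y\<bar> \<le> L * d x y"
  shows "\<bar>step f x - step f y\<bar> \<le> L * \<kappa> * d x y"
proof -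
  have "fst ` set_pmf C \<subseteq> set_pmf \<mu>" "snd ` set_pmf C \<subseteq> set_pmf \<mu>"
    using C closed by (metis set_map_pmf)+
  then have sub: "set_pmf C \<subseteq> set_pmf \<mu> \<times> set_pmf \<mu>"
    by force
  then have "finite (set_pmf C)"
    using finite_support by (rule finite_subset[OF _ finite_cartesian_product[OF _ finite_support]])
  then have int [simp]: "integrable (measure_pmf C) g" for g :: "'b \<times> 'b \<Rightarrow> real"
    by (rule integrable_measure_pmf_finite)
  have "step f x - step f y = measure_pmf.expectation C (\<lambda>z. f (fst z) - f (snd z))"
    by (simp add: step_def flip: C(1,2))
  also have "\<bar>\<dots>\<bar> \<le> measure_pmf.expectation C (\<lambda>z. \<bar>f (fst z) - f (snd z)\<bar>)"
    by (rule integral_abs_bound)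
  also have "\<dots> \<le> measure_pmf.expectation C (\<lambda>z. L * (case z of (x', y') \<Rightarrow> d x' y'))"
    using sub L(2) by (intro integral_mono_AE int AE_pmfI) force
  also have "\<dots> \<le> L * \<kappa> * d x y"
    using mult_left_mono[OF contr L(1)] by (simp add: mult.assoc)
  finally show ?thesis .
qed

lemma ex_Lipschitz_const:
  fixes d :: "'b \<Rightarrow> 'b \<Rightarrow> real"
  assumes pos: "\<And>x y. x \<in> set_pmf \<mu> \<Longrightarrow> y \<in> set_pmf \<mu> \<Longrightarrow> x \<noteq> y \<Longrightarrow> 0 < d x y"
    and nonneg: "\<And>x y. x \<in> set_pmf \<mu> \<Longrightarrow> y \<in> set_pmf \<mu> \<Longrightarrow> 0 \<le> d x y"
  obtains L where "0 \<le> L"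
    "\<And>x y. x \<in> set_pmf \<mu> \<Longrightarrow> y \<in> set_pmf \<mu> \<Longrightarrow> \<bar>f x - f y\<bar> \<le> L * d x y"
proof
  let ?q = "\<lambda>z. \<bar>f (fst z) - f (snd z)\<bar> / d (fst z) (snd z)"
  let ?L = "\<Sum>z\<in>set_pmf \<mu> \<times> set_pmf \<mu>. ?q z"
  have q: "0 \<le> ?q z" if "z \<in> set_pmf \<mu> \<times> set_pmf \<mu>" for z
    using that nonneg by (auto intro!: divide_nonneg_nonneg)
  show "0 \<le> ?L"
    by (intro sum_nonneg q)
  fix x y assume xy: "x \<in> set_pmf \<mu>" "y \<in> set_pmf \<mu>"
  show "\<bar>f x - f y\<bar> \<le> ?L * d x y"
  proof (cases "x = y")
    case True
    then show ?thesis
      using \<open>0 \<le> ?L\<close> nonneg xy by simp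
  next
    case False
    have "?q (x, y) \<le> ?L"
      using xy finite_support q by (intro member_le_sum) auto
    then show ?thesis
      using pos[OF xy False] by (simp add: field_simps)
  qed
qed

text \<open>
  The differences of \<open>P\<^sup>m f\<close> are of order \<open>\<kappa>\<^sup>m\<close> by iterating the Lipschitz contraction; as the mean
  of \<open>P\<^sup>m f\<close> is still zero, so are its values. The constant \<open>B\<close> depends on \<open>d\<close> and \<open>f\<close>, but it disappears
  in the limit of large \<open>m\<close>, which is why any metric will do.
\<close>

lemma mean_step_power_decay:
  fixes d :: "'b \<Rightarrow> 'b \<Rightarrow> real"
  assumes pos: "\<And>x y. x \<in> set_pmf \<mu> \<Longrightarrow> y \<in> set_pmf \<mu> \<Longrightarrow> x \<noteq> y \<Longrightarrow> 0 < d x y"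
    and nonneg: "\<And>x y. x \<in> set_pmf \<mu> \<Longrightarrow> y \<in> set_pmf \<mu> \<Longrightarrow> 0 \<le> d x y"
    and coupling: "\<And>x y. x \<in> set_pmf \<mu> \<Longrightarrow> y \<in> set_pmf \<mu> \<Longrightarrow>
      \<exists>C. map_pmf fst C = K x \<and> map_pmf snd C = K y \<and>
        measure_pmf.expectation C (\<lambda>(x', y'). d x' y') \<le> \<kappa> * d x y"
    and "0 \<le> \<kappa>" and centred: "mean f = 0"
  obtains B where "\<And>m. mean (\<lambda>x. f x * (step ^^ m) f x) \<le> B * \<kappa> ^ m"
proof -
  obtain L where L: "0 \<le> L"
    "\<And>x y. x \<in> set_pmf \<mu> \<Longrightarrow> y \<in> set_pmf \<mu> \<Longrightarrow> \<bar>f x - f y\<bar> \<le> L * d x y"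
    by (rule ex_Lipschitz_const[of d f]) (use pos nonneg in auto)
  have lip: "\<bar>(step ^^ m) f x - (step ^^ m) f y\<bar> \<le> (L * \<kappa> ^ m) * d x y"
    if "x \<in> set_pmf \<mu>" "y \<in> set_pmf \<mu>" for m x y
    using that
  proof (induction m arbitrary: x y)
    case (Suc m)
    obtain C where C: "map_pmf fst C = K x" "map_pmf snd C = K y"
      "measure_pmf.expectation C (\<lambda>(x', y'). d x' y') \<le> \<kappa> * d x y"
      using coupling Suc.prems by blast
    have "\<bar>step ((step ^^ m) f) x - step ((step ^^ m) f) y\<bar> \<le> (L * \<kappa> ^ m) * \<kappa> * d x y"
      using C Suc L(1) \<open>0 \<le> \<kappa>\<close> by (intro coupling_Lipschitz) auto
    then show ?case
      by (simp add: mult_ac)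
  qed (use L(2) in simp)
  let ?B = "\<lambda>x. mean (\<lambda>y. L * d x y)"
  have sup: "\<bar>(step ^^ m) f x\<bar> \<le> \<kappa> ^ m * ?B x" if x: "x \<in> set_pmf \<mu>" for m x
  proof -
    have "(step ^^ m) f x = mean (\<lambda>y. (step ^^ m) f x - (step ^^ m) f y)"
      by (simp add: mean_step_power centred)
    also have "\<bar>\<dots>\<bar> \<le> mean (\<lambda>y. \<bar>(step ^^ m) f x - (step ^^ m) f y\<bar>)"
      by (rule integral_abs_bound)
    also have "\<dots> \<le> mean (\<lambda>y. \<kappa> ^ m * (L * d x y))"
      using lip[OF x] by (intro mean_mono) (simp add: mult_ac)
    finally show ?thesis
      by simp
  qed
  have "mean (\<lambda>x. f x * (step ^^ m) f x) \<le> mean (\<lambda>x. \<bar>f x\<bar> * ?B x) * \<kappa> ^ m" for m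
  proof -
    have "mean (\<lambda>x. f x * (step ^^ m) f x) \<le> mean (\<lambda>x. \<bar>f x\<bar> * (\<kappa> ^ m * ?B x))"
    proof (rule mean_mono)
      fix x assume "x \<in> set_pmf \<mu>"
      have "f x * (step ^^ m) f x \<le> \<bar>f x\<bar> * \<bar>(step ^^ m) f x\<bar>"
        by (metis abs_ge_self abs_mult)
      also have "\<dots> \<le> \<bar>f x\<bar> * (\<kappa> ^ m * ?B x)"
        by (intro mult_left_mono sup \<open>x \<in> set_pmf \<mu>\<close>) simp
      finally show "f x * (step ^^ m) f x \<le> \<bar>f x\<bar> * (\<kappa> ^ m * ?B x)" .
    qed
    also have "\<dots> = mean (\<lambda>x. (\<bar>f x\<bar> * ?B x) * \<kappa> ^ m)"
      by (simp add: mult_ac)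
    finally show ?thesis by simp
  qed
  then show thesis ..
qed

text \<open>
  Put \<open>a\<^sub>m = \<langle>f, P\<^sup>m f\<rangle>\<close>. As \<open>P\<close> is self-adjoint, \<open>a\<^sub>2\<^sub>m\<close> is the squared norm of \<open>P\<^sup>m f\<close>, so
  Cauchy-Schwarz gives \<open>a\<^sub>m\<^sup>2 \<le> a\<^sub>0 * a\<^sub>2\<^sub>m\<close>. Along the powers of two the ratios \<open>a\<^sub>m / a\<^sub>0\<close> therefore grow
  at least like \<open>(a\<^sub>1 / a\<^sub>0)\<^sup>m\<close>, which the decay assumption forbids if \<open>a\<^sub>1 > \<kappa> * a\<^sub>0\<close>.
\<close>

lemma mean_step_le_of_power_decay:
  assumes decay: "\<And>m. mean (\<lambda>x. f x * (step ^^ m) f x) \<le> B * \<kappa> ^ m" and "0 < \<kappa>"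
  shows "mean (\<lambda>x. f x * step f x) \<le> \<kappa> * mean (\<lambda>x. (f x)\<^sup>2)"
proof (rule ccontr)
  define a where "a m = mean (\<lambda>x. f x * (step ^^ m) f x)" for m
  have a0: "a 0 = mean (\<lambda>x. (f x)\<^sup>2)"
    by (simp add: a_def power2_eq_square)
  have doubling: "(a m)\<^sup>2 \<le> a 0 * a (2 * m)" for m
  proof -
    have "a (2 * m) = mean (\<lambda>x. f x * (step ^^ m) ((step ^^ m) f) x)"
      by (simp add: a_def mult_2 funpow_add)
    also have "\<dots> = mean (\<lambda>x. ((step ^^ m) f x)\<^sup>2)"
      by (simp only: self_adjoint_power power2_eq_square)
    finally show ?thesis
      using Cauchy_Schwarz_mean[of f "(step ^^ m) f"] by (simp add: a0 flip: a_def)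
  qed
  assume "\<not> ?thesis"
  then have gt: "\<kappa> * a 0 < a 1"
    by (simp add: a0) (simp add: a_def)
  have "0 \<le> a 0"
    unfolding a0 by (intro mean_nonneg) simp
  moreover have "a 0 \<noteq> 0"
    using doubling[of 1] gt by auto
  ultimately have "0 < a 0" by simp
  \<comment> \<open>The factor by which \<open>a 1 / a 0\<close> exceeds \<open>\<kappa>\<close>; its powers would have to stay bounded.\<close>
  define r where "r = a 1 / (\<kappa> * a 0)"
  have "1 < r"
    using gt \<open>0 < a 0\<close> \<open>0 < \<kappa>\<close> by (simp add: r_def)
  have ratio: "(\<kappa> * r) ^ 2 ^ k \<le> a (2 ^ k) / a 0" for k
  proof (induction k)
    case 0
    show ?case using \<open>0 < \<kappa>\<close> by (simp add: r_def)
  next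
    case (Suc k)
    have "(\<kappa> * r) ^ 2 ^ Suc k = ((\<kappa> * r) ^ 2 ^ k)\<^sup>2"
      by (metis power_Suc2 power_mult)
    also have "\<dots> \<le> (a (2 ^ k) / a 0)\<^sup>2"
      using Suc.IH \<open>0 < \<kappa>\<close> \<open>1 < r\<close> by (intro power_mono) auto
    also have "\<dots> = (a (2 ^ k))\<^sup>2 / (a 0 * a 0)"
      by (simp add: power_divide power2_eq_square)
    also have "\<dots> \<le> (a 0 * a (2 ^ Suc k)) / (a 0 * a 0)"
      using doubling[of "2 ^ k"] by (intro divide_right_mono) auto
    finally show ?case
      using \<open>0 < a 0\<close> by simp
  qed
  have bound: "r ^ 2 ^ k \<le> B / a 0" for k
  proof -
    have "\<kappa> ^ 2 ^ k * r ^ 2 ^ k \<le> a (2 ^ k) / a 0"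
      using ratio[of k] by (simp add: power_mult_distrib)
    also have "\<dots> \<le> \<kappa> ^ 2 ^ k * (B / a 0)"
      using decay[of "2 ^ k"] \<open>0 < a 0\<close> by (simp add: a_def divide_right_mono mult.commute)
    finally show ?thesis
      by (rule mult_left_le_imp_le) (use \<open>0 < \<kappa>\<close> in simp)
  qed
  obtain k where "B / a 0 < r ^ k"
    using real_arch_pow[OF \<open>1 < r\<close>] by blast
  also have "r ^ k \<le> r ^ 2 ^ k"
    using \<open>1 < r\<close> by (intro power_increasing) (auto simp: less_imp_le)
  finally show False
    using bound[of k] by simp
qed

theorem spectral_gap_of_contraction:
  fixes d :: "'b \<Rightarrow> 'b \<Rightarrow> real"
  assumes pos: "\<And>x y. x \<in> set_pmf \<mu> \<Longrightarrow> y \<in> set_pmf \<mu> \<Longrightarrow> x \<noteq> y \<Longrightarrow> 0 < d x y"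
    and nonneg: "\<And>x y. x \<in> set_pmf \<mu> \<Longrightarrow> y \<in> set_pmf \<mu> \<Longrightarrow> 0 \<le> d x y"
    and coupling: "\<And>x y. x \<in> set_pmf \<mu> \<Longrightarrow> y \<in> set_pmf \<mu> \<Longrightarrow>
      \<exists>C. map_pmf fst C = K x \<and> map_pmf snd C = K y \<and>
        measure_pmf.expectation C (\<lambda>(x', y'). d x' y') \<le> \<kappa> * d x y"
    and "0 < \<kappa>"
  shows "(1 - \<kappa>) * measure_pmf.variance \<mu> f \<le> dirichlet_form \<mu> K f"
proof -
  let ?g = "\<lambda>x. f x - mean f"
  have "mean ?g = 0" by simp
  then obtain B where "\<And>m. mean (\<lambda>x. ?g x * (step ^^ m) ?g x) \<le> B * \<kappa> ^ m"
    using mean_step_power_decay[OF pos nonneg coupling less_imp_le[OF \<open>0 < \<kappa>\<close>]] by blast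
  then have "mean (\<lambda>x. ?g x * step ?g x) \<le> \<kappa> * mean (\<lambda>x. (?g x)\<^sup>2)"
    using \<open>0 < \<kappa>\<close> by (rule mean_step_le_of_power_decay)
  moreover have "dirichlet_form \<mu> K f = dirichlet_form \<mu> K ?g"
    by (simp add: dirichlet_form_def)
  ultimately show ?thesis
    by (simp add: dirichlet_form_eq[of ?g] left_diff_distrib)
qed

text \<open>
  If \<open>K\<close> does not change along its own transitions, \<open>P\<close> is a projection, so that
  \<open>\<langle>f, P f\<rangle> = \<langle>P f, P f\<rangle> \<ge> 0\<close>.
\<close>

lemma dirichlet_form_le_second_moment:
  assumes idem: "\<And>x y. x \<in> set_pmf \<mu> \<Longrightarrow> y \<in> set_pmf (K x) \<Longrightarrow> K y = K x"
  shows "dirichlet_form \<mu> K f \<le> mean (\<lambda>x. (f x)\<^sup>2)"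
proof -
  have "step (step f) x = step f x" if x: "x \<in> set_pmf \<mu>" for x
  proof -
    have "step (step f) x = measure_pmf.expectation (K x) (\<lambda>_. step f x)"
      unfolding step_def[of "step f"]
      by (intro integral_cong_AE AE_pmfI) (auto simp: step_def idem[OF x])
    then show ?thesis by simp
  qed
  then have "mean (\<lambda>x. f x * step f x) = mean (\<lambda>x. f x * step (step f) x)"
    by (intro mean_cong) simp
  also have "\<dots> = mean (\<lambda>x. (step f x)\<^sup>2)"
    by (simp only: self_adjoint power2_eq_square)
  also have "\<dots> \<ge> 0"
    by (intro mean_nonneg) simp
  finally show ?thesis
    by (simp add: dirichlet_form_eq)
qed

end

section \<open>The Glauber kernel as a mixture of single-site updates\<close>

text \<open>
  Resampling from \<open>\<mu>\<close> conditioned on the block of a partition is reversible: for \<open>x\<close> and \<open>y\<close> in the same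
  block \<open>A\<close> both sides of detailed balance are \<open>\<mu>(x) * \<mu>(y) / \<mu>(A)\<close>, and otherwise both vanish.
\<close>

lemma reversible_kernel_cond_pmf:
  assumes fin: "finite (set_pmf \<mu>)"
    and self: "\<And>x. x \<in> set_pmf \<mu> \<Longrightarrow> x \<in> A x"
    and block: "\<And>x y. y \<in> A x \<Longrightarrow> A y = A x"
  shows "reversible_kernel \<mu> (\<lambda>x. cond_pmf \<mu> (A x))"
proof
  have ne: "set_pmf \<mu> \<inter> A x \<noteq> {}" if "x \<in> set_pmf \<mu>" for x
    using self[OF that] that by blast
  show "set_pmf (cond_pmf \<mu> (A x)) \<subseteq> set_pmf \<mu>" if "x \<in> set_pmf \<mu>" for x
    using ne[OF that] by simp
  show "pmf \<mu> x * pmf (cond_pmf \<mu> (A x)) y = pmf \<mu> y * pmf (cond_pmf \<mu> (A y)) x"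
    if "x \<in> set_pmf \<mu>" "y \<in> set_pmf \<mu>" for x y
  proof (cases "y \<in> A x")
    case True
    then have "A y = A x" by (rule block)
    then show ?thesis
      using True that self[of x] by (simp add: pmf_cond[OF ne])
  next
    case False
    then have "x \<notin> A y"
      using block[of x y] self[of y] that by blast
    then show ?thesis
      using False that by (simp add: pmf_cond[OF ne])
  qed
qed (rule fin)

definition agree_off :: "nat \<Rightarrow> nat \<Rightarrow> (nat \<Rightarrow> 'a) \<Rightarrow> (nat \<Rightarrow> 'a) set" where
  "agree_off n i x = {\<tau>. \<forall>j\<in>{..<n} - {i}. \<tau> j = x j}"

lemma agree_off_self: "x \<in> agree_off n i x"
  by (simp add: agree_off_def)

lemma agree_off_eq: "y \<in> agree_off n i x \<Longrightarrow> agree_off n i y = agree_off n i x"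
  by (auto simp: agree_off_def)

lemma set_pmf_agree_off_nonempty: "x \<in> set_pmf \<mu> \<Longrightarrow> set_pmf \<mu> \<inter> agree_off n i x \<noteq> {}"
  using agree_off_self by fast

definition site_update :: "nat \<Rightarrow> (nat \<Rightarrow> 'a) pmf \<Rightarrow> nat \<Rightarrow> (nat \<Rightarrow> 'a) \<Rightarrow> (nat \<Rightarrow> 'a) pmf" where
  "site_update n \<mu> i x = cond_pmf \<mu> (agree_off n i x)"

lemma site_update_reversible:
  "finite (set_pmf \<mu>) \<Longrightarrow> reversible_kernel \<mu> (site_update n \<mu> i)"
  unfolding site_update_def
  by (intro reversible_kernel_cond_pmf agree_off_self agree_off_eq)

lemma set_site_update:
  "x \<in> set_pmf \<mu> \<Longrightarrow> set_pmf (site_update n \<mu> i x) = set_pmf \<mu> \<inter> agree_off n i x"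
  unfolding site_update_def by (intro set_cond_pmf set_pmf_agree_off_nonempty)

lemma site_update_idempotent:
  assumes "x \<in> set_pmf \<mu>" "y \<in> set_pmf (site_update n \<mu> i x)"
  shows "site_update n \<mu> i y = site_update n \<mu> i x"
proof -
  have "y \<in> agree_off n i x"
    using assms by (simp add: set_site_update)
  then show ?thesis
    by (simp add: site_update_def agree_off_eq)
qed

text \<open>
  Configurations in the product are extensional, so a configuration that agrees with \<open>x\<close> off \<open>i\<close> is
  itself the result of writing its \<open>i\<close>-th coordinate into \<open>x\<close>.
\<close>

lemma glauber_step_eq_mixture:
  assumes supp: "set_pmf \<mu> \<subseteq> config_space n Om" and x: "x \<in> set_pmf \<mu>" and "n \<ge> 1"
  shows "glauber_step n \<mu> x = bind_pmf (pmf_of_set {..<n}) (\<lambda>i. site_update n \<mu> i x)"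
  unfolding glauber_step_def
proof (rule bind_pmf_cong[OF refl])
  fix i assume "i \<in> set_pmf (pmf_of_set {..<n})"
  then have "i < n"
    using \<open>n \<ge> 1\<close> by (subst (asm) set_pmf_of_set) (auto simp: lessThan_empty_iff)
  have "x(i := \<tau> i) = \<tau>" if \<tau>: "\<tau> \<in> set_pmf (site_update n \<mu> i x)" for \<tau>
  proof
    fix j
    have "\<tau> \<in> agree_off n i x" and "\<tau> \<in> config_space n Om" and "x \<in> config_space n Om"
      using \<tau> x supp by (auto simp: set_site_update)
    then have "j \<noteq> i \<Longrightarrow> j < n \<Longrightarrow> \<tau> j = x j" "\<not> j < n \<Longrightarrow> \<tau> j = x j"
      unfolding agree_off_def config_space_def by (blast, metis PiE_arb lessThan_iff)
    then show "(x(i := \<tau> i)) j = \<tau> j"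
      by (cases "j < n") auto
  qed
  then have "map_pmf (\<lambda>\<tau>. x(i := \<tau> i)) (site_update n \<mu> i x) = map_pmf id (site_update n \<mu> i x)"
    by (intro map_pmf_cong) auto
  then show "map_pmf (\<lambda>\<tau>. x(i := \<tau> i)) (cond_pmf \<mu> {\<tau>. \<forall>j\<in>{..<n} - {i}. \<tau> j = x j})
      = site_update n \<mu> i x"
    by (simp add: site_update_def agree_off_def pmf.map_id)
qed

lemma pmf_glauber_step:
  assumes "set_pmf \<mu> \<subseteq> config_space n Om" "x \<in> set_pmf \<mu>" "n \<ge> 1"
  shows "pmf (glauber_step n \<mu> x) y = (\<Sum>i<n. pmf (site_update n \<mu> i x) y) / real n"
  using assms(3) unfolding glauber_step_eq_mixture[OF assms]
  by (subst pmf_bind_pmf_of_set) (auto simp: lessThan_empty_iff)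

lemma glauber_step_reversible:
  assumes fin: "finite (set_pmf \<mu>)" and supp: "set_pmf \<mu> \<subseteq> config_space n Om" and "n \<ge> 1"
  shows "reversible_kernel \<mu> (glauber_step n \<mu>)"
proof
  fix x assume x: "x \<in> set_pmf \<mu>"
  show "set_pmf (glauber_step n \<mu> x) \<subseteq> set_pmf \<mu>"
    unfolding glauber_step_eq_mixture[OF supp x \<open>n \<ge> 1\<close>] using x by (auto simp: set_site_update)
  fix y assume y: "y \<in> set_pmf \<mu>"
  show "pmf \<mu> x * pmf (glauber_step n \<mu> x) y = pmf \<mu> y * pmf (glauber_step n \<mu> y) x"
    using reversible_kernel.detailed_balance[OF site_update_reversible[OF fin] x y, of n]
    unfolding pmf_glauber_step[OF supp x \<open>n \<ge> 1\<close>] pmf_glauber_step[OF supp y \<open>n \<ge> 1\<close>]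
    by (simp add: sum_distrib_left)
qed (rule fin)

lemma dirichlet_form_glauber:
  assumes supp: "set_pmf \<mu> \<subseteq> config_space n Om" and "n \<ge> 1"
  shows "dirichlet_form \<mu> (glauber_step n \<mu>) f
    = (\<Sum>i<n. dirichlet_form \<mu> (site_update n \<mu> i) f) / real n"
proof -
  have "dirichlet_form \<mu> (glauber_step n \<mu>) f
      = (\<Sum>x\<in>set_pmf \<mu>. \<Sum>y\<in>set_pmf \<mu>. \<Sum>i<n.
          pmf \<mu> x * pmf (site_update n \<mu> i x) y * (f x - f y)\<^sup>2 / (2 * real n))"
    unfolding dirichlet_form_def sum_divide_distrib
    by (intro sum.cong refl)
      (simp add: pmf_glauber_step[OF supp _ \<open>n \<ge> 1\<close>] sum_distrib_left sum_distrib_right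
        sum_divide_distrib mult.commute[of 2])
  also have "\<dots> = (\<Sum>i<n. \<Sum>x\<in>set_pmf \<mu>. \<Sum>y\<in>set_pmf \<mu>.
          pmf \<mu> x * pmf (site_update n \<mu> i x) y * (f x - f y)\<^sup>2 / (2 * real n))"
    by (subst sum.swap, subst (2) sum.swap) (rule refl)
  finally show ?thesis
    by (simp add: dirichlet_form_def sum_divide_distrib)
qed

text \<open>
  A transition at site \<open>i\<close> leaves all summands but the \<open>i\<close>-th unchanged, so the Dirichlet form is that
  of the single function \<open>\<phi>\<^sub>i(\<sigma>\<^sub>i)\<close>, to which the bound for projections applies.
\<close>

lemma dirichlet_form_site_additive:
  assumes fin: "finite (set_pmf \<mu>)" and "i < n"
  shows "dirichlet_form \<mu> (site_update n \<mu> i) (\<lambda>\<sigma>. \<Sum>j<n. \<phi> j (\<sigma> j))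
    \<le> measure_pmf.expectation \<mu> (\<lambda>\<sigma>. (\<phi> i (\<sigma> i))\<^sup>2)"
proof -
  have diff: "(\<Sum>j<n. \<phi> j (x j)) - (\<Sum>j<n. \<phi> j (y j)) = \<phi> i (x i) - \<phi> i (y i)"
    if "y \<in> agree_off n i x" for x y
  proof -
    have "(\<Sum>j\<in>{..<n} - {i}. \<phi> j (x j)) = (\<Sum>j\<in>{..<n} - {i}. \<phi> j (y j))"
      using that by (intro sum.cong) (auto simp: agree_off_def)
    then show ?thesis
      using \<open>i < n\<close> by (simp add: sum.remove[of "{..<n}" i])
  qed
  have "dirichlet_form \<mu> (site_update n \<mu> i) (\<lambda>\<sigma>. \<Sum>j<n. \<phi> j (\<sigma> j))
      = dirichlet_form \<mu> (site_update n \<mu> i) (\<lambda>\<sigma>. \<phi> i (\<sigma> i))"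
    unfolding dirichlet_form_def
  proof (intro arg_cong2[where f = "(/)"] sum.cong refl)
    fix x y assume xy: "x \<in> set_pmf \<mu>" "y \<in> set_pmf \<mu>"
    show "pmf \<mu> x * pmf (site_update n \<mu> i x) y * ((\<Sum>j<n. \<phi> j (x j)) - (\<Sum>j<n. \<phi> j (y j)))\<^sup>2
        = pmf \<mu> x * pmf (site_update n \<mu> i x) y * (\<phi> i (x i) - \<phi> i (y i))\<^sup>2"
    proof (cases "y \<in> set_pmf (site_update n \<mu> i x)")
      case True
      then show ?thesis
        using xy by (simp add: diff set_site_update)
    next
      case False
      then show ?thesis by (simp add: set_pmf_iff)
    qed
  qed
  also have "\<dots> \<le> measure_pmf.expectation \<mu> (\<lambda>\<sigma>. (\<phi> i (\<sigma> i))\<^sup>2)"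
    by (intro reversible_kernel.dirichlet_form_le_second_moment[OF site_update_reversible[OF fin]]
        site_update_idempotent)
  finally show ?thesis .
qed

text \<open>
  The approximate tensorization of variance for sums of single-site functions that spectral
  independence amounts to.
\<close>

theorem variance_additive_le:
  assumes fin: "finite (set_pmf \<mu>)" and supp: "set_pmf \<mu> \<subseteq> config_space n Om" and "n \<ge> 1"
    and metric: "Metric_space (config_space n Om) d"
    and "0 < \<kappa>" and dagger: "dagger_property n \<mu> d \<kappa>"
  shows "real n * (1 - \<kappa>) * measure_pmf.variance \<mu> (\<lambda>\<sigma>. \<Sum>i<n. \<phi> i (\<sigma> i))
    \<le> measure_pmf.expectation \<mu> (\<lambda>\<sigma>. \<Sum>i<n. (\<phi> i (\<sigma> i))\<^sup>2)"
proof -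
  interpret d: Metric_space "config_space n Om" d by (rule metric)
  interpret reversible_kernel \<mu> "glauber_step n \<mu>"
    by (rule glauber_step_reversible[OF fin supp \<open>n \<ge> 1\<close>])
  let ?f = "\<lambda>\<sigma>. \<Sum>i<n. \<phi> i (\<sigma> i)"
  have "(1 - \<kappa>) * measure_pmf.variance \<mu> ?f \<le> dirichlet_form \<mu> (glauber_step n \<mu>) ?f"
  proof (rule spectral_gap_of_contraction)
    show "0 < d x y" if "x \<in> set_pmf \<mu>" "y \<in> set_pmf \<mu>" "x \<noteq> y" for x y
      using that subsetD[OF supp] by (simp add: less_le)
    show "\<exists>C. map_pmf fst C = glauber_step n \<mu> x \<and> map_pmf snd C = glauber_step n \<mu> y \<and>
        measure_pmf.expectation C (\<lambda>(x', y'). d x' y') \<le> \<kappa> * d x y"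
      if "x \<in> set_pmf \<mu>" "y \<in> set_pmf \<mu>" for x y
      using dagger that by (simp add: dagger_property_def glauber_coupling_def conj_assoc)
  qed (use \<open>0 < \<kappa>\<close> in simp_all)
  also have "\<dots> = (\<Sum>i<n. dirichlet_form \<mu> (site_update n \<mu> i) ?f) / real n"
    by (rule dirichlet_form_glauber[OF supp \<open>n \<ge> 1\<close>])
  also have "\<dots> \<le> (\<Sum>i<n. measure_pmf.expectation \<mu> (\<lambda>\<sigma>. (\<phi> i (\<sigma> i))\<^sup>2)) / real n"
    by (intro divide_right_mono sum_mono dirichlet_form_site_additive[OF fin]) auto
  finally show ?thesis
    using \<open>n \<ge> 1\<close> by (simp add: field_simps)
qed

section \<open>Correlation matrix and variance of linear functions\<close>

text \<open>
  Removes the enumeration of the index set: an eigenvector is a function on the ground set that is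
  not identically zero on the elements of positive probability.
\<close>

lemma eigenvalue_correlation_matrix_iff:
  fixes \<nu> :: "'e set pmf" and k :: real
  assumes "finite E"
  shows "eigenvalue (correlation_matrix E \<nu>) k \<longleftrightarrow>
    (\<exists>\<phi>. (\<exists>a\<in>correlation_index E \<nu>. \<phi> a \<noteq> 0) \<and>
      (\<forall>a\<in>correlation_index E \<nu>. (\<Sum>b\<in>correlation_index E \<nu>. correlation \<nu> a b * \<phi> b) = k * \<phi> a))"
    (is "?L \<longleftrightarrow> ?R")
proof -
  define I where "I = correlation_index E \<nu>"
  define N where "N = card I"
  define e where "e = from_nat_into I"
  define M where "M = correlation_matrix E \<nu>"
  have fin: "finite I"
    using assms by (simp add: I_def correlation_index_def)
  have bij: "bij_betw e {..<N} I"
    unfolding e_def N_def by (rule bij_betw_from_nat_into_finite[OF fin])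
  have M: "M = mat N N (\<lambda>(i, j). correlation \<nu> (e i) (e j))"
    by (simp add: M_def correlation_matrix_def Let_def I_def N_def e_def)
  have mult: "(M *\<^sub>v vec N (\<lambda>j. \<phi> (e j))) = vec N (\<lambda>i. \<Sum>b\<in>I. correlation \<nu> (e i) b * \<phi> b)"
    for \<phi> :: "'e \<Rightarrow> real"
  proof (rule eq_vecI)
    fix i assume "i < dim_vec (vec N (\<lambda>i. \<Sum>b\<in>I. correlation \<nu> (e i) b * \<phi> b))"
    then have "i < N" by simp
    then have "vec_index (M *\<^sub>v vec N (\<lambda>j. \<phi> (e j))) i
        = (\<Sum>j<N. correlation \<nu> (e i) (e j) * \<phi> (e j))"
      by (simp add: M scalar_prod_def lessThan_atLeast0)
    also have "\<dots> = (\<Sum>b\<in>I. correlation \<nu> (e i) b * \<phi> b)"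
      using sum.reindex_bij_betw[OF bij, of "\<lambda>b. correlation \<nu> (e i) b * \<phi> b"] by simp
    finally show "vec_index (M *\<^sub>v vec N (\<lambda>j. \<phi> (e j))) i
        = vec_index (vec N (\<lambda>i. \<Sum>b\<in>I. correlation \<nu> (e i) b * \<phi> b)) i"
      using \<open>i < N\<close> by simp
  qed (simp add: M)
  have eigen: "eigenvector M (vec N (\<lambda>j. \<phi> (e j))) k \<longleftrightarrow>
      (\<exists>a\<in>I. \<phi> a \<noteq> 0) \<and> (\<forall>a\<in>I. (\<Sum>b\<in>I. correlation \<nu> a b * \<phi> b) = k * \<phi> a)" for \<phi>
  proof -
    have "eigenvector M (vec N (\<lambda>j. \<phi> (e j))) k \<longleftrightarrow>
      (\<exists>j<N. \<phi> (e j) \<noteq> 0) \<and> (\<forall>i<N. (\<Sum>b\<in>I. correlation \<nu> (e i) b * \<phi> b) = k * \<phi> (e i))"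
      unfolding eigenvector_def mult by (auto simp: M vec_eq_iff)
    moreover have "(\<forall>a\<in>I. P a) \<longleftrightarrow> (\<forall>j<N. P (e j))" "(\<exists>a\<in>I. P a) \<longleftrightarrow> (\<exists>j<N. P (e j))" for P
      using bij by (auto simp: bij_betw_def)
    ultimately show ?thesis
      by simp
  qed
  have "?L \<longleftrightarrow> (\<exists>\<phi>. eigenvector M (vec N (\<lambda>j. \<phi> (e j))) k)"
  proof
    assume ?L
    then obtain v where v: "eigenvector M v k"
      by (auto simp: eigenvalue_def M_def)
    define \<phi> where "\<phi> a = vec_index v (the_inv_into {..<N} e a)" for a
    have "v \<in> carrier_vec N"
      using v by (simp add: eigenvector_def M)
    then have "v = vec N (\<lambda>j. \<phi> (e j))"
      using bij by (intro eq_vecI) (auto simp: \<phi>_def bij_betw_def the_inv_into_f_f)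
    then show "\<exists>\<phi>. eigenvector M (vec N (\<lambda>j. \<phi> (e j))) k"
      using v by metis
  qed (auto simp: eigenvalue_def M_def)
  then show ?thesis
    unfolding eigen I_def .
qed

text \<open>
  Multiplied by \<open>\<P>(a \<in> S)\<close>, the correlation becomes the covariance of two indicators. The
  separate formula for the diagonal is consistent with this, since \<open>\<P>(a \<in> S \<bar> a \<in> S) = 1\<close>.
\<close>

lemma prob_mult_correlation:
  fixes \<nu> :: "'e set pmf"
  assumes "measure_pmf.prob \<nu> {S. a \<in> S} > 0"
  shows "measure_pmf.prob \<nu> {S. a \<in> S} * correlation \<nu> a b =
    measure_pmf.prob \<nu> {S. a \<in> S \<and> b \<in> S} - measure_pmf.prob \<nu> {S. a \<in> S} * measure_pmf.prob \<nu> {S. b \<in> S}"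
  using assms by (simp add: correlation_def cond_prob_def right_diff_distrib conj_commute)

context
  fixes E :: "'e set" and \<nu> :: "'e set pmf" and I :: "'e set"
  assumes finE: "finite E" and sub: "\<And>S. S \<in> set_pmf \<nu> \<Longrightarrow> S \<subseteq> E"
  defines "I \<equiv> correlation_index E \<nu>"
begin

lemma finite_index: "finite I"
  using finE by (simp add: I_def correlation_index_def)

lemma prob_pos_index: "a \<in> I \<Longrightarrow> measure_pmf.prob \<nu> {S. a \<in> S} > 0"
  by (simp add: I_def correlation_index_def)

lemma support_subset_index:
  assumes "S \<in> set_pmf \<nu>"
  shows "S \<subseteq> I"
proof
  fix a assume "a \<in> S"
  have "measure_pmf.prob \<nu> {S. a \<in> S} \<noteq> 0"
    using assms \<open>a \<in> S\<close> by (auto simp: measure_pmf_zero_iff)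
  then show "a \<in> I"
    using sub[OF assms] \<open>a \<in> S\<close>
    by (auto simp: I_def correlation_index_def zero_less_measure_iff)
qed

lemma integrable_subset_pmf: "integrable (measure_pmf \<nu>) (f :: 'e set \<Rightarrow> real)"
proof (rule integrable_measure_pmf_finite)
  show "finite (set_pmf \<nu>)"
    by (rule finite_subset[of _ "Pow E"]) (use sub finE in auto)
qed

text \<open>
  Turns sums over the random set \<open>S\<close>, in which linear functions of a configuration are naturally
  written, into sums over the fixed index set of the matrix.
\<close>

lemma expectation_sum_over_set:
  fixes g :: "'e set \<Rightarrow> real"
  shows "measure_pmf.expectation \<nu> (\<lambda>S. g S * (\<Sum>b\<in>S. \<phi> b))
    = (\<Sum>b\<in>I. measure_pmf.expectation \<nu> (\<lambda>S. g S * indicator {S. b \<in> S} S) * \<phi> b)"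
proof -
  have "g S * (\<Sum>b\<in>S. \<phi> b) = (\<Sum>b\<in>I. g S * indicator {S. b \<in> S} S * \<phi> b)"
    if "S \<in> set_pmf \<nu>" for S
  proof -
    have "(\<Sum>b\<in>I. g S * indicator {S. b \<in> S} S * \<phi> b) = (\<Sum>b\<in>S. g S * indicator {S. b \<in> S} S * \<phi> b)"
      using support_subset_index[OF that] finite_index by (intro sum.mono_neutral_right) auto
    then show ?thesis
      by (simp add: sum_distrib_left)
  qed
  then have "measure_pmf.expectation \<nu> (\<lambda>S. g S * (\<Sum>b\<in>S. \<phi> b))
      = measure_pmf.expectation \<nu> (\<lambda>S. \<Sum>b\<in>I. g S * indicator {S. b \<in> S} S * \<phi> b)"
    by (intro integral_cong_AE AE_pmfI) auto
  also have "\<dots> = (\<Sum>b\<in>I. measure_pmf.expectation \<nu> (\<lambda>S. g S * indicator {S. b \<in> S} S * \<phi> b))"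
    by (rule Bochner_Integration.integral_sum) (rule integrable_subset_pmf)
  finally show ?thesis by simp
qed

lemma expectation_of_sum_over_set:
  "measure_pmf.expectation \<nu> (\<lambda>S. \<Sum>b\<in>S. \<phi> b) = (\<Sum>b\<in>I. measure_pmf.prob \<nu> {S. b \<in> S} * \<phi> b)"
  using expectation_sum_over_set[of "\<lambda>_. 1" \<phi>] by simp

lemma correlation_row:
  assumes "a \<in> I"
  shows "measure_pmf.prob \<nu> {S. a \<in> S} * (\<Sum>b\<in>I. correlation \<nu> a b * \<phi> b)
    = measure_pmf.expectation \<nu> (\<lambda>S. indicator {S. a \<in> S} S * (\<Sum>b\<in>S. \<phi> b))
      - measure_pmf.prob \<nu> {S. a \<in> S} * measure_pmf.expectation \<nu> (\<lambda>S. \<Sum>b\<in>S. \<phi> b)"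
proof -
  have joint: "measure_pmf.expectation \<nu> (\<lambda>S. indicator {S. a \<in> S} S * indicator {S. b \<in> S} S)
      = measure_pmf.prob \<nu> {S. a \<in> S \<and> b \<in> S}" for b
    by (simp flip: indicator_inter_arith add: Collect_conj_eq)
  have "measure_pmf.prob \<nu> {S. a \<in> S} * (\<Sum>b\<in>I. correlation \<nu> a b * \<phi> b)
      = (\<Sum>b\<in>I. (measure_pmf.prob \<nu> {S. a \<in> S} * correlation \<nu> a b) * \<phi> b)"
    by (simp add: sum_distrib_left mult.assoc)
  also have "\<dots> = (\<Sum>b\<in>I. measure_pmf.prob \<nu> {S. a \<in> S \<and> b \<in> S} * \<phi> b)
      - measure_pmf.prob \<nu> {S. a \<in> S} * (\<Sum>b\<in>I. measure_pmf.prob \<nu> {S. b \<in> S} * \<phi> b)"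
    unfolding prob_mult_correlation[OF prob_pos_index[OF assms]]
    by (simp add: left_diff_distrib sum_subtractf sum_distrib_left mult.assoc)
  finally show ?thesis
    unfolding expectation_sum_over_set expectation_of_sum_over_set joint .
qed

lemma correlation_quadratic_form:
  "(\<Sum>a\<in>I. measure_pmf.prob \<nu> {S. a \<in> S} * \<phi> a * (\<Sum>b\<in>I. correlation \<nu> a b * \<phi> b))
    = measure_pmf.variance \<nu> (\<lambda>S. \<Sum>b\<in>S. \<phi> b)"
proof -
  let ?f = "\<lambda>S. \<Sum>b\<in>S. \<phi> b"
  have "(\<Sum>a\<in>I. measure_pmf.prob \<nu> {S. a \<in> S} * \<phi> a * (\<Sum>b\<in>I. correlation \<nu> a b * \<phi> b))
      = (\<Sum>a\<in>I. measure_pmf.expectation \<nu> (\<lambda>S. ?f S * indicator {S. a \<in> S} S) * \<phi> a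
          - measure_pmf.expectation \<nu> ?f * (measure_pmf.prob \<nu> {S. a \<in> S} * \<phi> a))"
  proof (rule sum.cong[OF refl])
    fix a assume "a \<in> I"
    have "measure_pmf.expectation \<nu> (\<lambda>S. ?f S * indicator {S. a \<in> S} S)
        = measure_pmf.expectation \<nu> (\<lambda>S. indicator {S. a \<in> S} S * ?f S)"
      by (simp only: mult.commute)
    then show "measure_pmf.prob \<nu> {S. a \<in> S} * \<phi> a * (\<Sum>b\<in>I. correlation \<nu> a b * \<phi> b)
      = measure_pmf.expectation \<nu> (\<lambda>S. ?f S * indicator {S. a \<in> S} S) * \<phi> a
          - measure_pmf.expectation \<nu> ?f * (measure_pmf.prob \<nu> {S. a \<in> S} * \<phi> a)"
      using arg_cong[OF correlation_row[OF \<open>a \<in> I\<close>, of \<phi>], of "\<lambda>t. t * \<phi> a"]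
      by (simp only: left_diff_distrib right_diff_distrib mult_ac)
  qed
  also have "\<dots> = (\<Sum>a\<in>I. measure_pmf.expectation \<nu> (\<lambda>S. ?f S * indicator {S. a \<in> S} S) * \<phi> a)
          - measure_pmf.expectation \<nu> ?f * (\<Sum>a\<in>I. measure_pmf.prob \<nu> {S. a \<in> S} * \<phi> a)"
    by (simp only: sum_subtractf sum_distrib_left)
  also have "\<dots> = measure_pmf.expectation \<nu> (\<lambda>S. ?f S * ?f S) - (measure_pmf.expectation \<nu> ?f)\<^sup>2"
    by (simp only: expectation_sum_over_set[of ?f] expectation_of_sum_over_set power2_eq_square)
  also have "\<dots> = measure_pmf.variance \<nu> ?f"
    by (subst measure_pmf.variance_eq) (auto simp: power2_eq_square integrable_subset_pmf)
  finally show ?thesis .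
qed

text \<open>
  The left side of the assumption is the quadratic form of the covariance matrix and the expectation
  on the right is that of the diagonal matrix of the \<open>\<P>(a \<in> S)\<close>, so the assumption bounds every
  Rayleigh quotient of the correlation matrix.
\<close>

lemma eigenvalue_correlation_le:
  assumes var: "\<And>\<phi>. measure_pmf.variance \<nu> (\<lambda>S. \<Sum>b\<in>S. \<phi> b)
      \<le> c * measure_pmf.expectation \<nu> (\<lambda>S. \<Sum>b\<in>S. (\<phi> b)\<^sup>2)"
    and ev: "eigenvalue (correlation_matrix E \<nu>) k"
  shows "k \<le> c"
proof -
  obtain \<phi> a where a: "a \<in> I" "\<phi> a \<noteq> 0"
    and eigen: "\<And>a. a \<in> I \<Longrightarrow> (\<Sum>b\<in>I. correlation \<nu> a b * \<phi> b) = k * \<phi> a"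
    using ev unfolding eigenvalue_correlation_matrix_iff[OF finE] I_def by blast
  let ?m = "\<Sum>a\<in>I. measure_pmf.prob \<nu> {S. a \<in> S} * (\<phi> a)\<^sup>2"
  have "0 < measure_pmf.prob \<nu> {S. a \<in> S} * (\<phi> a)\<^sup>2"
    using a prob_pos_index by simp
  also have "\<dots> \<le> ?m"
    by (rule member_le_sum) (use a finite_index in auto)
  finally have "0 < ?m" .
  have "k * ?m = (\<Sum>a\<in>I. measure_pmf.prob \<nu> {S. a \<in> S} * \<phi> a * (\<Sum>b\<in>I. correlation \<nu> a b * \<phi> b))"
    unfolding sum_distrib_left[of k] by (intro sum.cong refl) (simp add: eigen power2_eq_square)
  also have "\<dots> \<le> c * ?m"
    using var[of \<phi>] unfolding correlation_quadratic_form expectation_of_sum_over_set .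
  finally show ?thesis
    using \<open>0 < ?m\<close> by simp
qed

text \<open>
  The cardinality of \<open>S\<close> is constant, hence uncorrelated with every indicator, and the constant
  function is an eigenvector. This keeps the maximum over the spectrum from being taken over the empty
  set.
\<close>

lemma zero_eigenvalue_correlation:
  assumes "n \<ge> 1" and card: "\<And>S. S \<in> set_pmf \<nu> \<Longrightarrow> card S = n"
  shows "eigenvalue (correlation_matrix E \<nu>) 0"
proof -
  obtain S where S: "S \<in> set_pmf \<nu>"
    using set_pmf_not_empty[of \<nu>] by blast
  then have "S \<noteq> {}"
    using card[OF S] \<open>n \<ge> 1\<close> by auto
  then have "\<exists>a\<in>I. True"
    using support_subset_index[OF S] by blast
  moreover have "(\<Sum>b\<in>I. correlation \<nu> a b * 1) = 0 * 1" if a: "a \<in> I" for a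
  proof -
    have "measure_pmf.expectation \<nu> (\<lambda>S. g S * (\<Sum>b\<in>S. 1)) = measure_pmf.expectation \<nu> (\<lambda>S. g S * real n)"
      for g :: "'e set \<Rightarrow> real"
      by (intro integral_cong_AE AE_pmfI) (auto simp: card)
    from this[of "indicator {S. a \<in> S}"] this[of "\<lambda>_. 1"] show ?thesis
      using correlation_row[OF a, of "\<lambda>_. 1"] prob_pos_index[OF a] by simp
  qed
  ultimately show ?thesis
    unfolding eigenvalue_correlation_matrix_iff[OF finE] I_def[symmetric]
    by (intro exI[of _ "\<lambda>_. 1"]) auto
qed

end

lemma sum_homogenized:
  "(\<Sum>b\<in>(\<lambda>i. (\<sigma> i, i)) ` {..<n}. \<phi> b) = (\<Sum>i<n. \<phi> (\<sigma> i, i))"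
  by (subst sum.reindex) (auto simp: inj_on_def)

theorem theorem43:
  fixes n :: nat and Om :: "nat \<Rightarrow> 'a set" and \<mu> :: "(nat \<Rightarrow> 'a) pmf"
    and d :: "(nat \<Rightarrow> 'a) \<Rightarrow> (nat \<Rightarrow> 'a) \<Rightarrow> real" and \<epsilon> \<kappa> :: real
  assumes "n \<ge> 1"
    and "\<And>i. i < n \<Longrightarrow> finite (Om i)"
    and "set_pmf \<mu> \<subseteq> config_space n Om"
    and "\<epsilon> > 0"
    and "0 < \<kappa>" and "\<kappa> < 1" and "\<kappa> \<le> 1 - \<epsilon> / real n"
    and "Metric_space (config_space n Om) d"
    and "dagger_property n \<mu> d \<kappa>"
  shows "spectrally_independent n Om \<mu> (1 / \<epsilon>)"
proof -
  let ?E = "ground_set n Om" and ?\<nu> = "homogenization n \<mu>"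
  let ?M = "correlation_matrix ?E ?\<nu>"
  have fin: "finite (set_pmf \<mu>)"
    by (rule finite_subset[OF assms(3)]) (auto simp: config_space_def assms(2) intro: finite_PiE)
  have finE: "finite ?E"
    using assms(2) by (auto simp: ground_set_def)
  have sub: "S \<subseteq> ?E" if "S \<in> set_pmf ?\<nu>" for S
    using that assms(3) by (auto simp: homogenization_def ground_set_def config_space_def)
  have card: "card S = n" if "S \<in> set_pmf ?\<nu>" for S
    using that by (auto simp: homogenization_def card_image inj_on_def)
  have var: "measure_pmf.variance ?\<nu> (\<lambda>S. \<Sum>b\<in>S. \<phi> b)
      \<le> 1 / \<epsilon> * measure_pmf.expectation ?\<nu> (\<lambda>S. \<Sum>b\<in>S. (\<phi> b)\<^sup>2)" for \<phi> :: "'a \<times> nat \<Rightarrow> real"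
  proof -
    let ?f = "\<lambda>\<sigma>. \<Sum>i<n. \<phi> (\<sigma> i, i)"
    have "\<epsilon> \<le> real n * (1 - \<kappa>)"
      using assms(1,7) by (simp add: field_simps)
    then have "\<epsilon> * measure_pmf.variance \<mu> ?f \<le> real n * (1 - \<kappa>) * measure_pmf.variance \<mu> ?f"
      by (intro mult_right_mono measure_pmf.variance_positive)
    also have "\<dots> \<le> measure_pmf.expectation \<mu> (\<lambda>\<sigma>. \<Sum>i<n. (\<phi> (\<sigma> i, i))\<^sup>2)"
      using variance_additive_le[OF fin assms(3,1,8,5,9), of "\<lambda>i s. \<phi> (s, i)"] by simp
    finally show ?thesis
      using \<open>\<epsilon> > 0\<close> by (simp add: homogenization_def sum_homogenized field_simps)
  qed
  have "finite (spectrum ?M)"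
    by (rule card_finite_spectrum(1)[of _ "dim_row ?M"]) (simp add: correlation_matrix_def Let_def)
  moreover have "0 \<in> spectrum ?M"
    unfolding spectrum_def using zero_eigenvalue_correlation[OF finE sub \<open>n \<ge> 1\<close> card] by simp
  moreover have "k \<le> 1 / \<epsilon>" if "k \<in> spectrum ?M" for k
    using that eigenvalue_correlation_le[OF finE sub var] by (simp add: spectrum_def)
  ultimately show ?thesis
    unfolding spectrally_independent_def by (subst Max_le_iff) auto
qed

end
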